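(* The states in $\mathbb{C}^2\otimes\mathbb{C}^2$ that are entangled, non-diagonal, and orthogonal to $|00\rangle_{AB}$ are exactly the states characterized by three non-zero complex numbers $a,b,c$ with $|a|^2+|b|^2+|c|^2=1$ through the Schmidt decomposition $$|\psi\rangle_{AB}=\sum_{j=0}^1\eta_j\left(\frac{|x_j\rangle_A}{\||x_j\rangle\|}\right)\otimes\left(\frac{|y_j^*\rangle_B}{\||y_j\rangle\|}\right),$$ where $$\eta_j=\left(\frac{1+(-1)^j\sqrt{1-4|ab|^2}}{2}\right)^{1/2},\quad |x_j\rangle=\begin{bmatrix}a(\eta_j^2-|b|^2)\\ c\,\eta_j^2\end{bmatrix},\quad |y_j\rangle=\begin{bmatrix}b^*c\\ \eta_j^2-|b|^2\end{bmatrix}.$$ In particular $|x_0\rangle\perp|x_1\rangle$ and $|y_0\rangle\perp|y_1\rangle$.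
   Context: $|0\rangle,|1\rangle$ is the standard basis of $\mathbb{C}^2$, $|jk\rangle_{AB}=|j\rangle_A\otimes|k\rangle_B$, column vectors are with respect to the standard basis, $^*$ on scalars is complex conjugation, and $|y^*\rangle$ is the entrywise complex conjugate of $|y\rangle$. A state is a unit vector; a state in $\mathbb{C}^2\otimes\mathbb{C}^2$ is a product state if it equals $|u\rangle\otimes|v\rangle$, and entangled otherwise. A state $\sum_{j,k}c_{jk}|jk\rangle_{AB}$ is called diagonal if $c_{00}^*c_{01}+c_{10}^*c_{11}=0$, and non-diagonal otherwise. A Schmidt decomposition of a state is an expression $\sum_j\lambda_j|u_j\rangle\otimes|v_j\rangle$ with $\lambda_j\ge 0$ (the Schmidt coefficients) and $\{|u_j\rangle\}$, $\{|v_j\rangle\}$ orthonormal families in $\mathbb{C}^2$. *)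

theory Defs
  imports "HOL-Analysis.Analysis"
begin

(* The numeral type 2 has exactly the elements 0 and 1, so it is used directly as the index set
   of the standard basis. (HOL-Analysis' "vector [p, q]" would number the entries 1, 2 = 0.) *)
type_synonym qubit = "complex ^ 2"

(* C^2 (x) C^2 in coordinates: entry (j, k) is the coefficient of |jk>. The norm on this type
   is the Euclidean one. *)
type_synonym two_qubit = "complex ^ (2 \<times> 2)"

definition col :: "complex \<Rightarrow> complex \<Rightarrow> qubit" where
  "col p q = (\<chi> i. if i = 0 then p else q)"

definition ket :: "2 \<Rightarrow> qubit" where
  "ket j = axis j 1"

definition tensor :: "qubit \<Rightarrow> qubit \<Rightarrow> two_qubit"  (infixl "\<otimes>" 72) where
  "u \<otimes> v = (\<chi> p. u $ fst p * v $ snd p)"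

lemma ket_expansion: "\<psi> = (\<Sum>j\<in>UNIV. \<Sum>k\<in>UNIV. \<psi> $ (j, k) *s (ket j \<otimes> ket k))"
proof -
  have "(\<Sum>j\<in>UNIV. \<Sum>k\<in>UNIV. \<psi> $ (j, k) * (ket j $ m * ket k $ n)) = \<psi> $ (m, n)" for m n
  proof -
    have "(\<Sum>j\<in>UNIV. \<Sum>k\<in>UNIV. \<psi> $ (j, k) * (ket j $ m * ket k $ n))
        = (\<Sum>j\<in>UNIV. \<Sum>k\<in>UNIV. if k = n then if j = m then \<psi> $ (j, k) else 0 else 0)"
      by (intro sum.cong refl) (auto simp: ket_def axis_def)
    then show ?thesis
      by simp
  qed
  then show ?thesis
    by (simp add: vec_eq_iff tensor_def)
qed

(* The inner product of HOL-Analysis on complex ^ 'n is only the real part of this one. *)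
definition cinner :: "complex ^ 'n \<Rightarrow> complex ^ 'n \<Rightarrow> complex" where
  "cinner u v = (\<Sum>i\<in>UNIV. cnj (u $ i) * v $ i)"

definition conj_vec :: "complex ^ 'n \<Rightarrow> complex ^ 'n" where
  "conj_vec v = (\<chi> i. cnj (v $ i))"

definition is_state :: "two_qubit \<Rightarrow> bool" where
  "is_state \<psi> \<longleftrightarrow> norm \<psi> = 1"

definition product :: "two_qubit \<Rightarrow> bool" where
  "product \<psi> \<longleftrightarrow> (\<exists>u v. \<psi> = u \<otimes> v)"

abbreviation entangled :: "two_qubit \<Rightarrow> bool" where
  "entangled \<psi> \<equiv> \<not> product \<psi>"

definition diagonal :: "two_qubit \<Rightarrow> bool" where
  "diagonal \<psi> \<longleftrightarrow> cnj (\<psi> $ (0, 0)) * \<psi> $ (0, 1) + cnj (\<psi> $ (1, 0)) * \<psi> $ (1, 1) = 0"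

definition orthonormal_family :: "'i set \<Rightarrow> ('i \<Rightarrow> complex ^ 'n) \<Rightarrow> bool" where
  "orthonormal_family J u \<longleftrightarrow> (\<forall>i\<in>J. \<forall>j\<in>J. cinner (u i) (u j) = (if i = j then 1 else 0))"

definition schmidt_decomposition ::
  "'i set \<Rightarrow> ('i \<Rightarrow> real) \<Rightarrow> ('i \<Rightarrow> qubit) \<Rightarrow> ('i \<Rightarrow> qubit) \<Rightarrow> two_qubit \<Rightarrow> bool" where
  "schmidt_decomposition J l u v \<psi> \<longleftrightarrow>
     finite J \<and> (\<forall>j\<in>J. l j \<ge> 0) \<and> orthonormal_family J u \<and> orthonormal_family J v \<and>
     \<psi> = (\<Sum>j\<in>J. l j *\<^sub>R (u j \<otimes> v j))"

definition params :: "complex \<Rightarrow> complex \<Rightarrow> complex \<Rightarrow> bool" where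
  "params a b c \<longleftrightarrow>
     a \<noteq> 0 \<and> b \<noteq> 0 \<and> c \<noteq> 0 \<and> (cmod a)\<^sup>2 + (cmod b)\<^sup>2 + (cmod c)\<^sup>2 = 1"

definition eta :: "complex \<Rightarrow> complex \<Rightarrow> nat \<Rightarrow> real" where
  "eta a b j = sqrt ((1 + (- 1) ^ j * sqrt (1 - 4 * (cmod (a * b))\<^sup>2)) / 2)"

definition xvec :: "complex \<Rightarrow> complex \<Rightarrow> complex \<Rightarrow> nat \<Rightarrow> qubit" where
  "xvec a b c j =
     col (a * of_real ((eta a b j)\<^sup>2 - (cmod b)\<^sup>2)) (c * of_real ((eta a b j)\<^sup>2))"

definition yvec :: "complex \<Rightarrow> complex \<Rightarrow> complex \<Rightarrow> nat \<Rightarrow> qubit" where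
  "yvec a b c j = col (cnj b * c) (of_real ((eta a b j)\<^sup>2 - (cmod b)\<^sup>2))"

definition psi :: "complex \<Rightarrow> complex \<Rightarrow> complex \<Rightarrow> two_qubit" where
  "psi a b c = (\<Sum>j = 0..1. eta a b j *\<^sub>R
     ((xvec a b c j /\<^sub>R norm (xvec a b c j)) \<otimes>
      (conj_vec (yvec a b c j) /\<^sub>R norm (yvec a b c j))))"

end

theory Submission
  imports Defs
begin

text \<open>
  Put \<open>M = [[0, a], [b, c]]\<close>, the coefficient matrix of \<open>a|01> + b|10> + c|11>\<close>. Then
  \<open>M y\<^sub>j = x\<^sub>j\<close>, the \<open>y\<^sub>j\<close> form an orthogonal basis and \<open>|x\<^sub>j| = \<eta>\<^sub>j |y\<^sub>j|\<close>, so the Schmidt sum is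
  \<open>M\<close> applied to the resolution of the identity by the normalized \<open>y\<^sub>j\<close>, that is, \<open>M\<close> itself.
  Among the unit vectors without \<open>|00>\<close>-component, entanglement of \<open>M\<close> means \<open>ab \<noteq> 0\<close>, and
  non-diagonality means \<open>b\<^sup>* c \<noteq> 0\<close>.
\<close>

section \<open>Coordinates over the index type \<open>2\<close> and the complex inner
  product\<close>

lemma sum_UNIV_2: "sum f (UNIV :: 2 set) = f 0 + f 1"
proof -
  \<comment> \<open>\<open>exhaust_2\<close> lists the elements as 1 and 2; as 0 differs from 1, it
    must be 2.\<close>
  have "i = 0 \<or> i = 1" for i :: 2
    by (metis exhaust_2 zero_neq_one)
  then have UNIV_2: "(UNIV :: 2 set) = {0, 1}"
    by auto
  show ?thesis
    unfolding UNIV_2 by simp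
qed

lemma forall_2_zero_one: "(\<forall>i :: 2. P i) \<longleftrightarrow> P 0 \<and> P 1"
  by (metis exhaust_2 zero_neq_one)

lemma sum_UNIV_2x2:
  "sum f (UNIV :: (2 \<times> 2) set) = f (0, 0) + f (0, 1) + (f (1, 0) + f (1, 1))"
  by (simp add: UNIV_Times_UNIV [symmetric] sum.cartesian_product' sum_UNIV_2
      del: UNIV_Times_UNIV)

lemma two_qubit_eq_iff:
  "\<phi> = \<psi> \<longleftrightarrow> \<phi> $ (0, 0) = \<psi> $ (0, 0) \<and> \<phi> $ (0, 1) = \<psi> $ (0, 1) \<and>
     \<phi> $ (1, 0) = \<psi> $ (1, 0) \<and> \<phi> $ (1, 1) = \<psi> $ (1, 1)"
  for \<phi> \<psi> :: two_qubit
  by (simp add: vec_eq_iff split_paired_All forall_2_zero_one)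

lemma col_nth [simp]: "col p q $ 0 = p" "col p q $ 1 = q"
  by (simp_all add: col_def)

lemma tensor_nth [simp]: "(u \<otimes> v) $ (j, k) = u $ j * v $ k"
  by (simp add: tensor_def)

lemma conj_vec_nth [simp]: "conj_vec v $ i = cnj (v $ i)"
  by (simp add: conj_vec_def)

lemma cinner_conj_vec: "cinner (conj_vec u) (conj_vec v) = cnj (cinner u v)"
  by (simp add: cinner_def)

lemma cinner_scaleR: "cinner (r *\<^sub>R u) (s *\<^sub>R v) = of_real (r * s) * cinner u v"
  by (simp add: cinner_def scaleR_conv_of_real [where 'a = complex] sum_distrib_left algebra_simps)

lemma cinner_self: "cinner v v = of_real ((norm v)\<^sup>2)"
  by (simp add: cinner_def norm_vec_def L2_set_def sum_nonneg mult.commute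
      flip: complex_norm_square)

lemma cinner_commute: "cinner v u = cnj (cinner u v)"
  by (simp add: cinner_def mult.commute)

lemma conj_vec_eq_0_iff: "conj_vec v = 0 \<longleftrightarrow> v = 0"
  by (simp add: vec_eq_iff)

lemma norm_conj_vec: "norm (conj_vec v) = norm v"
  by (simp add: norm_vec_def)

lemma orthonormal_family_normalize:
  assumes "\<And>i. i \<in> J \<Longrightarrow> v i \<noteq> 0"
    and "\<And>i j. i \<in> J \<Longrightarrow> j \<in> J \<Longrightarrow> i \<noteq> j \<Longrightarrow> cinner (v i) (v j) = 0"
  shows "orthonormal_family J (\<lambda>j. v j /\<^sub>R norm (v j))"
  using assms
  by (auto simp: orthonormal_family_def cinner_scaleR cinner_self power2_eq_square
      field_simps simp flip: of_real_mult of_real_inverse)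

section \<open>Vectors without a |00> component\<close>

definition superposition :: "complex \<Rightarrow> complex \<Rightarrow> complex \<Rightarrow> two_qubit" where
  "superposition a b c = (\<chi> p. if p = (0, 0) then 0 else if p = (0, 1) then a
     else if p = (1, 0) then b else c)"

lemma superposition_nth [simp]:
  "superposition a b c $ (0, 0) = 0" "superposition a b c $ (0, 1) = a"
  "superposition a b c $ (1, 0) = b" "superposition a b c $ (1, 1) = c"
  by (simp_all add: superposition_def)

text \<open>The |00> entry \<open>u $ 0 * v $ 0\<close> vanishes, so one factor does:
  \<open>u $ 0 = 0\<close> kills the |01> entry \<open>a\<close>, and \<open>v $ 0 = 0\<close> kills
  the |10> entry \<open>b\<close>.\<close>

lemma product_superposition_iff: "product (superposition a b c) \<longleftrightarrow> a = 0 \<or> b = 0"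
proof
  assume "product (superposition a b c)"
  then obtain u v where "superposition a b c = u \<otimes> v"
    by (auto simp: product_def)
  then show "a = 0 \<or> b = 0"
    by (auto simp: two_qubit_eq_iff)
next
  have "superposition 0 b c = col 0 1 \<otimes> col b c" "superposition a 0 c = col a c \<otimes> col 0 1"
    by (simp_all add: two_qubit_eq_iff)
  then show "a = 0 \<or> b = 0 \<Longrightarrow> product (superposition a b c)"
    by (auto simp: product_def)
qed

lemma norm_superposition:
  "(norm (superposition a b c))\<^sup>2 = (cmod a)\<^sup>2 + (cmod b)\<^sup>2 + (cmod c)\<^sup>2"
  by (simp add: norm_vec_def L2_set_def sum_nonneg sum_UNIV_2x2)

lemma cinner_ket_00: "cinner (ket 0 \<otimes> ket 0) \<psi> = \<psi> $ (0, 0)"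
  by (simp add: cinner_def sum_UNIV_2x2 ket_def axis_def)

lemma superposition_characterization:
  "is_state \<psi> \<and> entangled \<psi> \<and> \<not> diagonal \<psi> \<and> cinner (ket 0 \<otimes> ket 0) \<psi> = 0 \<longleftrightarrow>
     (\<exists>a b c. params a b c \<and> \<psi> = superposition a b c)"
proof -
  have *: "is_state (superposition a b c) \<and> entangled (superposition a b c) \<and>
      \<not> diagonal (superposition a b c) \<longleftrightarrow> params a b c" for a b c
  proof -
    have "is_state (superposition a b c) \<longleftrightarrow> (cmod a)\<^sup>2 + (cmod b)\<^sup>2 + (cmod c)\<^sup>2 = 1"
      by (simp add: is_state_def abs_square_eq_1 flip: norm_superposition)
    then show ?thesis
      by (auto simp: params_def product_superposition_iff diagonal_def)
  qed
  have "\<psi> $ (0, 0) = 0 \<longleftrightarrow> (\<exists>a b c. \<psi> = superposition a b c)"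
    by (auto simp: two_qubit_eq_iff)
  with * show ?thesis
    unfolding cinner_ket_00 by metis
qed

section \<open>Eigenvalues and eigenvectors of M^* M\<close>

context
  fixes a b c :: complex
  assumes params: "params a b c"
begin

text \<open>The distance of the eigenvalue \<eta>_j^2 of M^* M from its upper left entry |b|^2. As
  second entry of y_j it makes y_j an eigenvector.\<close>

abbreviation gap :: "nat \<Rightarrow> real" where
  "gap j \<equiv> (eta a b j)\<^sup>2 - (cmod b)\<^sup>2"

text \<open>By AM-GM, 4|ab|^2 is at most (|a|^2 + |b|^2)^2 = (1 - |c|^2)^2, which is below 1 since
  \<open>c\<close> is nonzero.\<close>

lemma discriminant_pos: "4 * (cmod (a * b))\<^sup>2 < 1"
proof -
  have "(cmod a)\<^sup>2 + (cmod b)\<^sup>2 < 1"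
    using params by (simp add: params_def) (smt (verit) zero_less_power zero_less_norm_iff)
  then have "((cmod a)\<^sup>2 + (cmod b)\<^sup>2)\<^sup>2 < 1"
    by (simp add: abs_square_less_1)
  moreover have "0 \<le> ((cmod a)\<^sup>2 - (cmod b)\<^sup>2)\<^sup>2"
    by simp
  ultimately show ?thesis
    by (simp add: norm_mult power2_sum power2_diff power_mult_distrib)
qed

text \<open>The inner root lies in [0, 1], so the outer radicand is nonnegative for either parity of
  \<open>j\<close>.\<close>

lemma eta_square: "(eta a b j)\<^sup>2 = (1 + (- 1) ^ j * sqrt (1 - 4 * (cmod (a * b))\<^sup>2)) / 2"
proof -
  have "sqrt (1 - 4 * (cmod (a * b))\<^sup>2) \<le> 1"
    by simp
  moreover have "0 \<le> sqrt (1 - 4 * (cmod (a * b))\<^sup>2)"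
    using discriminant_pos by simp
  ultimately show ?thesis
    by (cases "even j") (auto simp: eta_def)
qed

text \<open>The equation is the characteristic equation of M^* M, whose trace is 1 and whose
  determinant is |ab|^2.\<close>

lemma eta_square_root: "((eta a b j)\<^sup>2)\<^sup>2 = (eta a b j)\<^sup>2 - (cmod a)\<^sup>2 * (cmod b)\<^sup>2"
proof -
  define s where "s = sqrt (1 - 4 * (cmod (a * b))\<^sup>2)"
  have "s\<^sup>2 = 1 - 4 * ((cmod a)\<^sup>2 * (cmod b)\<^sup>2)"
    using discriminant_pos by (simp add: s_def norm_mult power_mult_distrib)
  then show ?thesis
    unfolding eta_square s_def [symmetric]
    by (cases "even j") (simp_all add: power2_eq_square field_simps)
qed

lemma eta_square_sum: "(eta a b 0)\<^sup>2 + (eta a b 1)\<^sup>2 = 1"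
  by (simp add: eta_square field_simps)

lemma eta_square_prod: "(eta a b 0)\<^sup>2 * (eta a b 1)\<^sup>2 = (cmod a)\<^sup>2 * (cmod b)\<^sup>2"
  using eta_square_root [of 0] eta_square_sum by algebra

text \<open>Zero is not a root of the characteristic equation, because its constant term |ab|^2 is
  nonzero.\<close>

lemma eta_pos: "0 < eta a b j"
proof -
  have "eta a b j \<noteq> 0"
    using eta_square_root [of j] params by (auto simp: params_def)
  moreover have "0 \<le> eta a b j"
    using zero_le_power2 [of "eta a b j"] unfolding eta_square by (simp add: eta_def)
  ultimately show ?thesis by simp
qed

text \<open>The left side is the characteristic polynomial t^2 - t + |ab|^2 evaluated at t =
  |b|^2.\<close>

lemma gap_prod: "gap 0 * gap 1 = - ((cmod b)\<^sup>2 * (cmod c)\<^sup>2)"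
proof -
  have "gap 0 * gap 1 = (eta a b 0)\<^sup>2 * (eta a b 1)\<^sup>2
      - (cmod b)\<^sup>2 * ((eta a b 0)\<^sup>2 + (eta a b 1)\<^sup>2) + (cmod b)\<^sup>2 * (cmod b)\<^sup>2"
    by (simp add: algebra_simps)
  also have "\<dots> = (cmod b)\<^sup>2 * ((cmod a)\<^sup>2 + (cmod b)\<^sup>2 - 1)"
    unfolding eta_square_prod eta_square_sum by (simp add: algebra_simps)
  also have "(cmod a)\<^sup>2 + (cmod b)\<^sup>2 - 1 = - (cmod c)\<^sup>2"
    using params by (simp add: params_def)
  finally show ?thesis by simp
qed

lemma gap_neq: "gap 0 \<noteq> gap 1"
  using discriminant_pos by (simp add: eta_square)

lemma norm_yvec: "(norm (yvec a b c j))\<^sup>2 = (cmod b)\<^sup>2 * (cmod c)\<^sup>2 + (gap j)\<^sup>2"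
  by (simp add: norm_vec_def L2_set_def sum_nonneg sum_UNIV_2 yvec_def norm_mult
      power_mult_distrib flip: of_real_diff of_real_power)

lemma norm_xvec: "norm (xvec a b c j) = eta a b j * norm (yvec a b c j)"
proof -
  define A B C t where "A = (cmod a)\<^sup>2" and "B = (cmod b)\<^sup>2" and "C = (cmod c)\<^sup>2"
    and "t = (eta a b j)\<^sup>2"
  have C: "C = 1 - A - B"
    using params by (simp add: params_def A_def B_def C_def)
  have t: "t * t = t - A * B"
    using eta_square_root [of j] by (simp add: t_def A_def B_def power2_eq_square)
  have "(norm (xvec a b c j))\<^sup>2 = A * (t - B)\<^sup>2 + C * t\<^sup>2"
    by (simp add: norm_vec_def L2_set_def sum_nonneg sum_UNIV_2 xvec_def norm_mult
        power_mult_distrib A_def B_def C_def t_def flip: of_real_diff of_real_power)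
  \<comment> \<open>The two sides differ by (t - B)(t - AB - t^2), and the second factor is zero by
    the characteristic equation.\<close>
  also have "\<dots> = t * (B * C + (t - B)\<^sup>2)"
    unfolding C using t by algebra
  also have "\<dots> = (eta a b j * norm (yvec a b c j))\<^sup>2"
    by (simp add: power_mult_distrib norm_yvec B_def C_def t_def)
  finally show ?thesis
    using eta_pos [of j] by (simp add: power2_eq_iff_nonneg)
qed

lemma yvec_nonzero: "yvec a b c j \<noteq> 0"
  using params norm_yvec [of j] by (auto simp: params_def add_nonneg_eq_0_iff)

lemma xvec_nonzero: "xvec a b c j \<noteq> 0"
  using norm_xvec [of j] eta_pos [of j] yvec_nonzero [of j] by auto

lemma cinner_yvec: "cinner (yvec a b c 0) (yvec a b c 1) = 0"
proof -
  have "cinner (yvec a b c 0) (yvec a b c 1) =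
      of_real ((cmod b)\<^sup>2 * (cmod c)\<^sup>2 + gap 0 * gap 1)"
    unfolding of_real_add of_real_mult complex_norm_square
    by (simp add: cinner_def sum_UNIV_2 yvec_def)
  then show ?thesis
    by (simp only: gap_prod) simp
qed

text \<open>The two entries contribute -|abc|^2 and +|abc|^2, by \<open>gap_prod\<close> and
  \<open>eta_square_prod\<close>.\<close>

lemma cinner_xvec: "cinner (xvec a b c 0) (xvec a b c 1) = 0"
proof -
  have "cinner (xvec a b c 0) (xvec a b c 1) = of_real
      ((cmod a)\<^sup>2 * (gap 0 * gap 1) + (cmod c)\<^sup>2 * ((eta a b 0)\<^sup>2 * (eta a b 1)\<^sup>2))"
    unfolding of_real_add of_real_mult complex_norm_square [of a] complex_norm_square [of c]
    by (simp add: cinner_def sum_UNIV_2 xvec_def)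
  then show ?thesis
    by (simp only: gap_prod eta_square_prod) simp
qed

lemma psi_eq_superposition: "psi a b c = superposition a b c"
proof -
  \<comment> \<open>Keeps the index 1 from turning into \<open>Suc 0\<close>, so that facts stated
    at index 1 still match.\<close>
  note One_nat_def [simp del]
  define N where "N j = (norm (yvec a b c j))\<^sup>2" for j
  \<comment> \<open>Replacing |bc|^2 by \<open>- (gap 0 * gap 1)\<close> makes the squared norms
    factor.\<close>
  have N: "N 0 = gap 0 * (gap 0 - gap 1)" "N 1 = - (gap 1 * (gap 0 - gap 1))"
    unfolding N_def norm_yvec using gap_prod by (simp_all add: power2_eq_square algebra_simps)
  have N_nonzero: "N 0 \<noteq> 0" "N 1 \<noteq> 0"
    using yvec_nonzero by (simp_all add: N_def)
  \<comment> \<open>The Schmidt coefficient cancels against |x_j| = \<eta>_j |y_j|, leaving 1 /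
    |y_j|^2.\<close>
  have coeff: "eta a b j *\<^sub>R ((xvec a b c j /\<^sub>R norm (xvec a b c j)) \<otimes>
      (conj_vec (yvec a b c j) /\<^sub>R norm (yvec a b c j))) =
      (1 / N j) *\<^sub>R (xvec a b c j \<otimes> conj_vec (yvec a b c j))" for j
    using eta_pos [of j] yvec_nonzero [of j]
    by (simp add: two_qubit_eq_iff norm_xvec N_def power2_eq_square field_simps)
  text \<open>The entries of \<open>\<Sum>\<^sub>j r\<^sub>j y\<^sub>j y\<^sub>j\<^sup>* = 1\<close>, with \<open>r\<^sub>j = 1 / |y\<^sub>j|\<^sup>2\<close> and \<open>y\<^sub>j = (b\<^sup>* c, d\<^sub>j)\<close>.\<close>
  define r where "r j = 1 / N j" for j
  define d where "d j = gap j" for j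
  have nz: "d 0 \<noteq> 0" "d 1 \<noteq> 0" "d 0 - d 1 \<noteq> 0"
    using N N_nonzero gap_neq by (auto simp: d_def)
  have r: "r 0 = 1 / (d 0 * (d 0 - d 1))" "r 1 = - (1 / (d 1 * (d 0 - d 1)))"
    by (simp_all only: r_def N d_def minus_divide_right)
  \<comment> \<open>With \<open>q\<close> naming the only remaining reciprocal, the three identities
    become polynomial consequences of \<open>q\<close> and \<open>bc\<close>, within reach of
    \<open>algebra\<close>.\<close>
  define q where "q = 1 / (d 0 - d 1)"
  have q: "(d 0 - d 1) * q = 1" "d 0 * r 0 = q" "d 1 * r 1 = - q"
    using nz by (simp_all add: q_def r)
  have bc: "(cmod b)\<^sup>2 * (cmod c)\<^sup>2 = - (d 0 * d 1)"
    using gap_prod by (simp add: d_def)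
  have id00: "(cmod b)\<^sup>2 * (cmod c)\<^sup>2 * (r 0 + r 1) = 1"
    and id01: "d 0 * r 0 + d 1 * r 1 = 0"
    and id11: "d 0 * d 0 * r 0 + d 1 * d 1 * r 1 = 1"
    using q unfolding bc by algebra+
  note id_complex = id00 [THEN arg_cong [of _ _ complex_of_real]]
    id01 [THEN arg_cong [of _ _ complex_of_real]] id11 [THEN arg_cong [of _ _ complex_of_real]]
  have x: "xvec a b c j = col (a * of_real (d j)) (c * (of_real (d j) + b * cnj b))" for j
    by (simp add: xvec_def d_def complex_norm_square [symmetric] flip: of_real_power)
  have y: "yvec a b c j = col (cnj b * c) (of_real (d j))" for j
    by (simp add: yvec_def d_def)
  have psi: "psi a b c = r 0 *\<^sub>R (xvec a b c 0 \<otimes> conj_vec (yvec a b c 0)) +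
      r 1 *\<^sub>R (xvec a b c 1 \<otimes> conj_vec (yvec a b c 1))"
    unfolding psi_def coeff by (simp add: r_def One_nat_def)
  have ids: "b * cnj b * (c * cnj c) * (of_real (r 0) + of_real (r 1)) = 1"
    "of_real (d 0) * of_real (r 0) + of_real (d 1) * of_real (r 1) = (0 :: complex)"
    "of_real (d 0) * of_real (d 0) * of_real (r 0) + of_real (d 1) * of_real (d 1) * of_real (r 1)
      = (1 :: complex)"
    using id_complex
    by (simp_all only: of_real_add of_real_mult of_real_0 of_real_1 complex_norm_square)
  \<comment> \<open>Each entry is regrouped as a row of M times a column of the resolution of the
    identity, so that \<open>ids\<close> applies literally.\<close>
  have "psi a b c $ (0, 0) =
        a * b * cnj c * (of_real (d 0) * of_real (r 0) + of_real (d 1) * of_real (r 1))"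
    "psi a b c $ (0, 1) = a * (of_real (d 0) * of_real (d 0) * of_real (r 0) +
        of_real (d 1) * of_real (d 1) * of_real (r 1))"
    "psi a b c $ (1, 0) =
        c * b * cnj c * (of_real (d 0) * of_real (r 0) + of_real (d 1) * of_real (r 1)) +
        b * (b * cnj b * (c * cnj c) * (of_real (r 0) + of_real (r 1)))"
    "psi a b c $ (1, 1) = c * (of_real (d 0) * of_real (d 0) * of_real (r 0) +
        of_real (d 1) * of_real (d 1) * of_real (r 1)) +
        c * b * cnj b * (of_real (d 0) * of_real (r 0) + of_real (d 1) * of_real (r 1))"
    by (simp_all add: psi x y scaleR_conv_of_real [where 'a = complex] algebra_simps)
  then show ?thesis
    unfolding ids by (simp add: two_qubit_eq_iff)
qed

end

theorem proposition5:
  "{\<psi> :: two_qubit. is_state \<psi> \<and> entangled \<psi> \<and> \<not> diagonal \<psi> \<and> cinner (ket 0 \<otimes> ket 0) \<psi> = 0} =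
     {psi a b c | a b c. params a b c} \<and>
   (\<forall>a b c. params a b c \<longrightarrow>
     schmidt_decomposition {0..1} (eta a b)
       (\<lambda>j. xvec a b c j /\<^sub>R norm (xvec a b c j))
       (\<lambda>j. conj_vec (yvec a b c j) /\<^sub>R norm (yvec a b c j))
       (psi a b c) \<and>
     cinner (xvec a b c 0) (xvec a b c 1) = 0 \<and>
     cinner (yvec a b c 0) (yvec a b c 1) = 0)"
proof (intro conjI allI impI)
  show "{\<psi>. is_state \<psi> \<and> entangled \<psi> \<and> \<not> diagonal \<psi> \<and> cinner (ket 0 \<otimes> ket 0) \<psi> = 0} =
      {psi a b c | a b c. params a b c}"
    unfolding superposition_characterization
    by (rule Collect_cong) (metis psi_eq_superposition)
next
  fix a b c
  assume params: "params a b c"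
  note One_nat_def [simp del]
  note x = cinner_xvec [OF params] and y = cinner_yvec [OF params]
  have x': "cinner (xvec a b c 1) (xvec a b c 0) = 0"
    using x cinner_commute [of "xvec a b c 1"] by simp
  have y': "cinner (yvec a b c 1) (yvec a b c 0) = 0"
    using y cinner_commute [of "yvec a b c 1"] by simp
  have index: "{0..1} = {0, 1 :: nat}"
    by auto
  have "orthonormal_family {0..1} (\<lambda>j. xvec a b c j /\<^sub>R norm (xvec a b c j))"
    using x x' xvec_nonzero [OF params]
    by (intro orthonormal_family_normalize) (auto simp: index)
  \<comment> \<open>Normalized by the norm of the conjugate, to fit
    \<open>orthonormal_family_normalize\<close>; \<open>norm_conj_vec\<close> restores the stated
    form.\<close>
  moreover have "orthonormal_family {0..1}
      (\<lambda>j. conj_vec (yvec a b c j) /\<^sub>R norm (conj_vec (yvec a b c j)))"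
    using y y' yvec_nonzero [OF params]
    by (intro orthonormal_family_normalize) (auto simp: index cinner_conj_vec conj_vec_eq_0_iff)
  ultimately show "schmidt_decomposition {0..1} (eta a b)
      (\<lambda>j. xvec a b c j /\<^sub>R norm (xvec a b c j))
      (\<lambda>j. conj_vec (yvec a b c j) /\<^sub>R norm (yvec a b c j)) (psi a b c)"
    using eta_pos [OF params]
    by (simp add: schmidt_decomposition_def psi_def norm_conj_vec less_imp_le)
  show "cinner (xvec a b c 0) (xvec a b c 1) = 0" "cinner (yvec a b c 0) (yvec a b c 1) = 0"
    by (fact x y)+
qed

end
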